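(* Let $k,t,m\in\mathbb{N}$. Then there exists $N_0=N(k,t,m)\in\mathbb{N}$ such that for every $m$-type colouring $\Delta:[N_0]\to\mathbb{N}^m$ at least one of the following holds: (1) there is an arithmetic progression $A\subseteq[N_0]$ of length $k$ which is monochromatic; (2) there is an arithmetic progression $B\subseteq[N_0]$ of length $t$ which is rainbow.
   Context: $[N]=\{1,\ldots,N\}$. An $m$-type colouring of $[N]$ is a map $\Delta:[N]\to\mathbb{N}^m$; for $a\in[N]$ and $j\in\{1,\ldots,m\}$, $\Delta_j(a)$ denotes the $j$-th coordinate of $\Delta(a)$. An arithmetic progression of length $\ell$ is a set $\{a,a+d,\ldots,a+(\ell-1)d\}$ with $a\in\mathbb{Z}$ and $d$ a positive integer. A set $\{a_1,\ldots,a_\ell\}$ is monochromatic if there is a coordinate $j\in\{1,\ldots,m\}$ with $\Delta_j(a_i)=\Delta_j(a_{i'})$ for all $i,i'$. It is rainbow if $\Delta_j(a_i)\neq\Delta_{j'}(a_{i'})$ for all $i\neq i'$ in $\{1,\ldots,\ell\}$ and all $j,j'\in\{1,\ldots,m\}$. *)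

theory Defs
  imports Main "HOL-Library.FuncSet"
begin

(* Nat^m is the set of functions from {1..m} to nat that are undefined off {1..m},
   so Delta a j is the j-th coordinate of the colour of a. *)
definition type_colouring :: "nat \<Rightarrow> nat \<Rightarrow> (int \<Rightarrow> nat \<Rightarrow> nat) \<Rightarrow> bool" where
  "type_colouring m N \<Delta> \<longleftrightarrow> \<Delta> \<in> {1..int N} \<rightarrow>\<^sub>E ({1..m} \<rightarrow>\<^sub>E UNIV)"

definition arith_progression :: "nat \<Rightarrow> int set \<Rightarrow> bool" where
  "arith_progression l A \<longleftrightarrow> (\<exists>a d. d > 0 \<and> A = (\<lambda>i. a + int i * d) ` {..<l})"

definition monochromatic :: "nat \<Rightarrow> (int \<Rightarrow> nat \<Rightarrow> nat) \<Rightarrow> int set \<Rightarrow> bool" where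
  "monochromatic m \<Delta> A \<longleftrightarrow> (\<exists>j\<in>{1..m}. \<forall>x\<in>A. \<forall>y\<in>A. \<Delta> x j = \<Delta> y j)"

(* j = j' is allowed; the coordinates of a single element may coincide. *)
definition rainbow :: "nat \<Rightarrow> (int \<Rightarrow> nat \<Rightarrow> nat) \<Rightarrow> int set \<Rightarrow> bool" where
  "rainbow m \<Delta> B \<longleftrightarrow>
    (\<forall>x\<in>B. \<forall>y\<in>B. x \<noteq> y \<longrightarrow> (\<forall>j\<in>{1..m}. \<forall>j'\<in>{1..m}. \<Delta> x j \<noteq> \<Delta> y j'))"

end

theory Submission
  imports Defs HOL.Modules "HOL-Library.Product_Plus"
begin

text \<open>
  Colour each pair \<open>(a, d)\<close> by the coincidence pattern of the progression \<open>a + i d\<close> for \<open>i < t\<close>,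
  that is, by the set of \<open>(i, p, j, j')\<close> with \<open>\<Delta>\<^sub>j(a + i d) = \<Delta>\<^sub>j\<^sub>'(a + p d)\<close>.  There are finitely
  many patterns, so Gallai's theorem in the plane gives \<open>(a, d)\<close> and \<open>e > 0\<close> such that all pairs
  \<open>(a - e p y, d + e y)\<close> have the same pattern.  If it contains no coincidence with \<open>i \<noteq> p\<close>, the
  progression \<open>a + i d\<close> is rainbow.  If it contains \<open>(i, p, j, j')\<close>, then moving along \<open>y\<close>
  leaves the \<open>p\<close>-th term \<open>a + p d\<close> fixed while the \<open>i\<close>-th term runs through
  \<open>a + i d + (i - p) e y\<close>, on which \<open>\<Delta>\<^sub>j\<close> is therefore constant.

  Gallai's theorem itself is proved by colour focusing, adding one point of the configuration
  at a time.
\<close>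

section \<open>Gallai's theorem by colour focusing\<close>

text \<open>Gallai's property in finite form: \<open>A\<close> and \<open>n\<close> are chosen
  before the colouring, so only finitely many copies of \<open>V\<close> compete. This keeps the
  windows in the induction finite and later bounds \<open>N\<^sub>0\<close>.\<close>

definition homothetic_ramsey :: "(int \<Rightarrow> 'b::ab_group_add \<Rightarrow> 'b) \<Rightarrow> 'b set \<Rightarrow> bool" where
  "homothetic_ramsey scale V \<longleftrightarrow>
    (\<forall>r::nat. \<exists>A n. finite A \<and> (\<forall>\<chi>::'b \<Rightarrow> nat. (\<forall>x. \<chi> x < r) \<longrightarrow>
      (\<exists>a\<in>A. \<exists>e\<in>{1..int n}. \<exists>c. \<forall>v\<in>V. \<chi> (a + scale e v) = c)))"

text \<open>Serves colourings whose colours are patterns: restrictions to a window in the focusing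
  step, coincidence sets in the final proof.\<close>

lemma homothetic_ramsey_finite_colours:
  fixes scale :: "int \<Rightarrow> 'b::ab_group_add \<Rightarrow> 'b" and C :: "'c set"
  assumes "homothetic_ramsey scale V" and "finite C"
  obtains A n where "finite A"
    and "\<And>\<chi>. range \<chi> \<subseteq> C \<Longrightarrow> \<exists>a\<in>A. \<exists>e\<in>{1..int n}. \<exists>c. \<forall>v\<in>V. \<chi> (a + scale e v) = c"
proof -
  obtain h :: "'c \<Rightarrow> nat" and r where h: "h ` C = {i. i < r}" "inj_on h C"
    using finite_imp_inj_to_nat_seg[OF \<open>finite C\<close>] by blast
  obtain A n where "finite A" and An:
    "\<And>\<chi>::'b \<Rightarrow> nat. \<forall>x. \<chi> x < r \<Longrightarrow> \<exists>a\<in>A. \<exists>e\<in>{1..int n}. \<exists>c. \<forall>v\<in>V. \<chi> (a + scale e v) = c"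
    using spec[OF assms(1)[unfolded homothetic_ramsey_def], of r] by (elim exE conjE) blast
  show thesis
  proof
    show "finite A" by fact
    fix \<chi> :: "'b \<Rightarrow> 'c" assume \<chi>: "range \<chi> \<subseteq> C"
    then have "\<forall>x. (h \<circ> \<chi>) x < r"
      using h(1) by auto
    from An[OF this] obtain a e c where ae: "a \<in> A" "e \<in> {1..int n}"
      and c: "\<And>v. v \<in> V \<Longrightarrow> h (\<chi> (a + scale e v)) = c"
      by auto
    have "\<chi> (a + scale e v) = inv_into C h c" if "v \<in> V" for v
      using c[OF that] \<chi> h(2) by (metis inv_into_f_f range_subsetD)
    with ae show "\<exists>a\<in>A. \<exists>e\<in>{1..int n}. \<exists>c. \<forall>v\<in>V. \<chi> (a + scale e v) = c"
      by blast
  qed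
qed

text \<open>The point \<open>f\<close> is the common focus: it is where 0 lands in each of these
  copies of \<open>V\<close>. Taking the colours as a set \<open>K\<close> makes
  \<open>card K\<close> count differently coloured copies.\<close>

definition colour_focused ::
  "(int \<Rightarrow> 'b::ab_group_add \<Rightarrow> 'b) \<Rightarrow> 'b set \<Rightarrow> ('b \<Rightarrow> nat) \<Rightarrow> nat set \<Rightarrow> nat \<Rightarrow> 'b \<Rightarrow> bool" where
  "colour_focused scale V \<chi> K n f \<longleftrightarrow>
    (\<forall>c\<in>K. \<exists>e\<in>{1..int n}. \<forall>v\<in>V. \<chi> (f + scale e v) = c)"

text \<open>Induction on the number \<open>s\<close> of focused colours: as long as no copy of
  \<open>insert 0 V\<close> is monochromatic, a focus can be found with one more colour.\<close>

lemma colour_focusing: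
  fixes scale :: "int \<Rightarrow> 'b::ab_group_add \<Rightarrow> 'b"
  assumes "module scale" and "homothetic_ramsey scale V" and "finite V" and "V \<noteq> {}"
  shows "\<exists>F n. finite F \<and> (\<forall>\<chi>. (\<forall>x. \<chi> x < r) \<longrightarrow>
      (\<exists>a\<in>F. \<exists>e\<in>{1..int n}. \<exists>c. \<forall>v\<in>insert 0 V. \<chi> (a + scale e v) = c) \<or>
      (\<exists>f\<in>F. \<exists>K\<subseteq>{..<r}. card K = s \<and> colour_focused scale V \<chi> K n f))"
proof (induction s)
  case 0
  show ?case
    by (rule exI[of _ "{0}"], rule exI[of _ 0]) (auto simp: colour_focused_def)
next
  case (Suc s)
  interpret module scale by fact
  obtain F n where F: "finite F" and Fn: "\<And>\<chi>. \<forall>x. \<chi> x < r \<Longrightarrow>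
      (\<exists>a\<in>F. \<exists>e\<in>{1..int n}. \<exists>c. \<forall>v\<in>insert 0 V. \<chi> (a + scale e v) = c) \<or>
      (\<exists>f\<in>F. \<exists>K\<subseteq>{..<r}. card K = s \<and> colour_focused scale V \<chi> K n f)"
    using Suc by (elim exE conjE) blast
  \<comment> \<open>A window holding every focus in \<open>F\<close> together with all copies of
    \<open>V\<close> that may be focused there.\<close>
  define W where "W = F \<union> (\<lambda>(f, e, v). f + scale e v) ` (F \<times> {1..int n} \<times> V)"
  have W: "finite W"
    unfolding W_def using F \<open>finite V\<close> by auto
  then have "finite (W \<rightarrow>\<^sub>E {..<r})"
    by (simp add: finite_PiE)
  from homothetic_ramsey_finite_colours[OF assms(2) this]
  obtain A q where A: "finite A" and Aq: "\<And>\<psi>. range \<psi> \<subseteq> W \<rightarrow>\<^sub>E {..<r} \<Longrightarrow>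
      \<exists>a\<in>A. \<exists>e\<in>{1..int q}. \<exists>c. \<forall>v\<in>V. \<psi> (a + scale e v) = c"
    by blast
  define F' where "F' = (\<lambda>(b, f). b + f) ` (A \<times> F)
      \<union> (\<lambda>(b, e, v, f). b + scale e v + f) ` (A \<times> {1..int q} \<times> V \<times> F)"
  have F': "finite F'"
    unfolding F'_def using F A \<open>finite V\<close> by auto
  have "(\<exists>a\<in>F'. \<exists>e\<in>{1..int (n + q)}. \<exists>c. \<forall>v\<in>insert 0 V. \<chi> (a + scale e v) = c) \<or>
      (\<exists>f\<in>F'. \<exists>K\<subseteq>{..<r}. card K = Suc s \<and> colour_focused scale V \<chi> K (n + q) f)"
    if \<chi>: "\<forall>x. \<chi> x < r" for \<chi> :: "'b \<Rightarrow> nat"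
  proof -
    \<comment> \<open>Each point \<open>g\<close> is coloured by the pattern of \<chi> on the
      translate of \<open>W\<close> by \<open>g\<close>. A copy of \<open>V\<close> monochromatic
      for this colouring gives equally coloured windows at all \<open>b + scale e v\<close>; the one
      at \<open>u\<close> serves as reference.\<close>
    have "range (\<lambda>g. \<lambda>x\<in>W. \<chi> (g + x)) \<subseteq> W \<rightarrow>\<^sub>E {..<r}"
      using \<chi> by auto
    from Aq[OF this] obtain b e c where b: "b \<in> A" and e: "e \<in> {1..int q}"
      and c: "\<And>v. v \<in> V \<Longrightarrow> (\<lambda>x\<in>W. \<chi> (b + scale e v + x)) = c"
      by auto
    obtain u where u: "u \<in> V" using \<open>V \<noteq> {}\<close> by blast
    have shift: "\<chi> (b + scale e v + x) = \<chi> (b + scale e u + x)" if "v \<in> V" "x \<in> W" for v x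
      using fun_cong[OF c[OF that(1)], of x] fun_cong[OF c[OF u], of x] that(2) by simp
    let ?\<chi> = "\<lambda>x. \<chi> (b + scale e u + x)"
    have "\<forall>x. ?\<chi> x < r" using \<chi> by simp
    from Fn[OF this] consider
        (mono) a e' c' where "a \<in> F" "e' \<in> {1..int n}"
          "\<And>v. v \<in> insert 0 V \<Longrightarrow> ?\<chi> (a + scale e' v) = c'"
      | (focus) f K where "f \<in> F" "K \<subseteq> {..<r}" "card K = s" "colour_focused scale V ?\<chi> K n f"
      by blast
    then show ?thesis
    proof cases
      case mono
      have "b + scale e u + a \<in> F'"
        unfolding F'_def using b e u mono(1) by force
      moreover have "e' \<in> {1..int (n + q)}" using mono(2) by auto
      moreover have "\<forall>v\<in>insert 0 V. \<chi> (b + scale e u + a + scale e' v) = c'"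
        using mono(3) by (simp add: add.assoc)
      ultimately show ?thesis by blast
    next
      case focus
      have mem: "b + f \<in> F'"
        unfolding F'_def using b focus(1) by force
      have fW: "f \<in> W" using focus(1) by (simp add: W_def)
      show ?thesis
      \<comment> \<open>If the focus has a colour from \<open>K\<close>, it completes the copy of
        that colour to one of \<open>insert 0 V\<close>. Otherwise its colour is new, and
        \<open>b + f\<close> becomes a focus for \<open>Suc s\<close> colours.\<close>
      proof (cases "?\<chi> f \<in> K")
        case True
        then obtain e' where e': "e' \<in> {1..int n}" "\<forall>v\<in>V. ?\<chi> (f + scale e' v) = ?\<chi> f"
          using focus(4) unfolding colour_focused_def by blast
        have "b + scale e u + f \<in> F'"
          unfolding F'_def using b e u focus(1) by force
        moreover have "e' \<in> {1..int (n + q)}" using e'(1) by auto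
        moreover have "\<forall>v\<in>insert 0 V. \<chi> (b + scale e u + f + scale e' v) = ?\<chi> f"
          using e'(2) by (simp add: add.assoc)
        ultimately show ?thesis by blast
      next
        case False
        let ?K = "insert (?\<chi> f) K"
        have "finite K" using focus(2) finite_subset by blast
        then have "card ?K = Suc s" using False focus(3) by simp
        moreover have "?K \<subseteq> {..<r}" using focus(2) \<chi> by simp
        moreover have "colour_focused scale V \<chi> ?K (n + q) (b + f)"
          unfolding colour_focused_def
        proof
          fix c' assume "c' \<in> ?K"
          then consider "c' = ?\<chi> f" | "c' \<in> K" by blast
          then show "\<exists>e\<in>{1..int (n + q)}. \<forall>v\<in>V. \<chi> (b + f + scale e v) = c'"
          proof cases
            case 1
            \<comment> \<open>The old focus, repeated in the window of each \<open>v\<close>, forms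
              the copy of the new colour.\<close>
            have "\<forall>v\<in>V. \<chi> (b + f + scale e v) = c'"
              using shift[OF _ fW] 1 by (simp add: ac_simps)
            moreover have "e \<in> {1..int (n + q)}" using e by auto
            ultimately show ?thesis by blast
          next
            case 2
            then obtain e' where e': "e' \<in> {1..int n}"
              and c': "\<And>v. v \<in> V \<Longrightarrow> ?\<chi> (f + scale e' v) = c'"
              using focus(4) unfolding colour_focused_def by blast
            \<comment> \<open>An old copy is spread diagonally: its point for \<open>v\<close> is
              taken from the window at \<open>b + scale e v\<close>, so the ratios add up.\<close>
            have "\<chi> (b + f + scale (e + e') v) = c'" if v: "v \<in> V" for v
            proof -
              have "f + scale e' v \<in> W"
                unfolding W_def using focus(1) e' v by force
              from shift[OF v this] c'[OF v] show ?thesis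
                by (simp add: scale_left_distrib ac_simps)
            qed
            moreover have "e + e' \<in> {1..int (n + q)}" using e e' by auto
            ultimately show ?thesis by blast
          qed
        qed
        ultimately show ?thesis using mem by blast
      qed
    qed
  qed
  with F' show ?case by (intro exI[of _ F'] exI[of _ "n + q"]) simp
qed

text \<open>Focusing \<open>Suc r\<close> colours is impossible with only \<open>r\<close>
  available, so the other alternative must occur.\<close>

lemma homothetic_ramsey_insert_zero:
  fixes scale :: "int \<Rightarrow> 'b::ab_group_add \<Rightarrow> 'b"
  assumes "module scale" and "homothetic_ramsey scale V" and "finite V" and "V \<noteq> {}"
  shows "homothetic_ramsey scale (insert 0 V)"
  unfolding homothetic_ramsey_def
proof
  fix r
  obtain F n where "finite F" and Fn: "\<And>\<chi>::'b \<Rightarrow> nat. \<forall>x. \<chi> x < r \<Longrightarrow>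
      (\<exists>a\<in>F. \<exists>e\<in>{1..int n}. \<exists>c. \<forall>v\<in>insert 0 V. \<chi> (a + scale e v) = c) \<or>
      (\<exists>f\<in>F. \<exists>K\<subseteq>{..<r}. card K = Suc r \<and> colour_focused scale V \<chi> K n f)"
    using colour_focusing[OF assms, of r "Suc r"] by (elim exE conjE) blast
  have "card K \<noteq> Suc r" if "K \<subseteq> {..<r}" for K
    using card_mono[OF _ that] by auto
  then have "\<exists>a\<in>F. \<exists>e\<in>{1..int n}. \<exists>c. \<forall>v\<in>insert 0 V. \<chi> (a + scale e v) = c"
    if "\<forall>x. \<chi> x < r" for \<chi> :: "'b \<Rightarrow> nat"
    using Fn[OF that] by blast
  with \<open>finite F\<close> show "\<exists>A n. finite A \<and> (\<forall>\<chi>. (\<forall>x. \<chi> x < r) \<longrightarrow>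
      (\<exists>a\<in>A. \<exists>e\<in>{1..int n}. \<exists>c. \<forall>v\<in>insert 0 V. \<chi> (a + scale e v) = c))"
    by (intro exI[of _ F] exI[of _ n]) simp
qed

lemma homothetic_ramsey_translate:
  fixes scale :: "int \<Rightarrow> 'b::ab_group_add \<Rightarrow> 'b"
  assumes "module scale" and "homothetic_ramsey scale V"
  shows "homothetic_ramsey scale ((\<lambda>v. v + p) ` V)"
  unfolding homothetic_ramsey_def
proof
  interpret module scale by fact
  fix r
  obtain A n where A: "finite A" and An:
    "\<And>\<chi>::'b \<Rightarrow> nat. \<forall>x. \<chi> x < r \<Longrightarrow> \<exists>a\<in>A. \<exists>e\<in>{1..int n}. \<exists>c. \<forall>v\<in>V. \<chi> (a + scale e v) = c"
    using spec[OF assms(2)[unfolded homothetic_ramsey_def], of r] by (elim exE conjE) blast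
  \<comment> \<open>Moving the base point by \<open>- scale e p\<close> cancels the translation of
    the configuration.\<close>
  let ?A = "(\<lambda>(a, e). a - scale e p) ` (A \<times> {1..int n})"
  have "\<exists>a\<in>?A. \<exists>e\<in>{1..int n}. \<exists>c. \<forall>v\<in>(\<lambda>v. v + p) ` V. \<chi> (a + scale e v) = c"
    if \<chi>: "\<forall>x. \<chi> x < r" for \<chi> :: "'b \<Rightarrow> nat"
  proof -
    from An[OF \<chi>] obtain a e c where ae: "a \<in> A" "e \<in> {1..int n}"
      and c: "\<forall>v\<in>V. \<chi> (a + scale e v) = c"
      by blast
    have "\<forall>v\<in>(\<lambda>v. v + p) ` V. \<chi> (a - scale e p + scale e v) = c"
      using c by (simp add: scale_right_distrib)
    moreover have "a - scale e p \<in> ?A" using ae by force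
    ultimately show ?thesis using ae(2) by blast
  qed
  then show "\<exists>A n. finite A \<and> (\<forall>\<chi>. (\<forall>x. \<chi> x < r) \<longrightarrow>
      (\<exists>a\<in>A. \<exists>e\<in>{1..int n}. \<exists>c. \<forall>v\<in>(\<lambda>v. v + p) ` V. \<chi> (a + scale e v) = c))"
    using A by (intro exI[of _ ?A] exI[of _ n]) auto
qed

theorem gallai:
  fixes scale :: "int \<Rightarrow> 'b::ab_group_add \<Rightarrow> 'b"
  assumes "module scale" and "finite V"
  shows "homothetic_ramsey scale V"
  using \<open>finite V\<close>
proof (induction V rule: finite_induct)
  case empty
  have "finite {0}" "(1::int) \<in> {1..int 1}" by auto
  then show ?case unfolding homothetic_ramsey_def by blast
next
  case (insert p V)
  show ?case
  \<comment> \<open>Focusing needs a nonempty \<open>V\<close>, so singletons are treated directly.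
    Otherwise \<open>p\<close> is moved to the origin, added there as 0, and moved back.\<close>
  proof (cases "V = {}")
    case True
    have "finite {0}" "(1::int) \<in> {1..int 1}" by auto
    then show ?thesis unfolding homothetic_ramsey_def True by blast
  next
    case False
    let ?V = "(\<lambda>v. v + - p) ` V"
    have "homothetic_ramsey scale (insert 0 ?V)"
      using insert False
      by (intro homothetic_ramsey_insert_zero homothetic_ramsey_translate assms(1)) auto
    from homothetic_ramsey_translate[OF assms(1) this, of p] show ?thesis
      by (simp add: image_image)
  qed
qed

section \<open>Gallai's theorem for pairs of integers\<close>

lemma module_int_pair: "module (\<lambda>(e::int) (x, y). (e * x, e * y))"
  by unfold_locales (auto simp: algebra_simps)

text \<open>The points of all competing copies are gathered in one finite set \<open>X\<close>, from
  which the size of \<open>N\<^sub>0\<close> is read off.\<close>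

lemma gallai_pairs:
  fixes V :: "(int \<times> int) set" and C :: "'c set"
  assumes "finite V" and "finite C"
  obtains X where "finite X"
    and "\<And>\<chi>::int \<times> int \<Rightarrow> 'c. range \<chi> \<subseteq> C \<Longrightarrow> \<exists>a d e c. e > 0 \<and>
      (\<forall>(x, y)\<in>V. (a + e * x, d + e * y) \<in> X \<and> \<chi> (a + e * x, d + e * y) = c)"
proof -
  obtain A n where A: "finite A" and An: "\<And>\<chi>::int \<times> int \<Rightarrow> 'c. range \<chi> \<subseteq> C \<Longrightarrow>
      \<exists>a\<in>A. \<exists>e\<in>{1..int n}. \<exists>c. \<forall>v\<in>V. \<chi> (a + (\<lambda>(x, y). (e * x, e * y)) v) = c"
    by (rule homothetic_ramsey_finite_colours[OF gallai[OF module_int_pair assms(1)] assms(2)]) blast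
  let ?X = "(\<lambda>((a, d), e, x, y). (a + e * x, d + e * y)) ` (A \<times> {1..int n} \<times> V)"
  show thesis
  proof
    show "finite ?X" using A \<open>finite V\<close> by auto
    fix \<chi> :: "int \<times> int \<Rightarrow> 'c" assume "range \<chi> \<subseteq> C"
    from An[OF this] obtain a d e c where ad: "(a, d) \<in> A" and e: "e \<in> {1..int n}"
      and c: "\<forall>v\<in>V. \<chi> ((a, d) + (\<lambda>(x, y). (e * x, e * y)) v) = c"
      by fast
    have "\<forall>(x, y)\<in>V. (a + e * x, d + e * y) \<in> ?X \<and> \<chi> (a + e * x, d + e * y) = c"
      using ad e c by (force simp: image_iff)
    moreover have "e > 0" using e by simp
    ultimately show "\<exists>a d e c. e > 0 \<and>
        (\<forall>(x, y)\<in>V. (a + e * x, d + e * y) \<in> ?X \<and> \<chi> (a + e * x, d + e * y) = c)"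
      by blast
  qed
qed

section \<open>Coincidence patterns of progressions\<close>

definition coincidences ::
  "nat \<Rightarrow> nat \<Rightarrow> (int \<Rightarrow> nat \<Rightarrow> nat) \<Rightarrow> int \<times> int \<Rightarrow> (nat \<times> nat \<times> nat \<times> nat) set" where
  "coincidences m t \<Delta> = (\<lambda>(a, d). {(i, p, j, j'). i < t \<and> p < t \<and> j \<in> {1..m} \<and> j' \<in> {1..m} \<and>
     \<Delta> (a + int i * d) j = \<Delta> (a + int p * d) j'})"

text \<open>A coincidence may be read in either direction, swapping the coordinates as well. The
  order \<open>p < i\<close> later makes the common difference \<open>(int i - int p) * e\<close>
  positive.\<close>

lemma rainbow_or_coincidence:
  assumes "\<not> rainbow m \<Delta> ((\<lambda>i. a + int i * d) ` {..<t})"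
  obtains i p j j' where "p < i" "(i, p, j, j') \<in> coincidences m t \<Delta> (a, d)"
proof -
  from assms obtain i p j j' where *: "i < t" "p < t" "j \<in> {1..m}" "j' \<in> {1..m}"
    "i \<noteq> p" "\<Delta> (a + int i * d) j = \<Delta> (a + int p * d) j'"
    unfolding rainbow_def by auto
  then consider "p < i" | "i < p" by linarith
  then show thesis
  proof cases
    case 1
    then show thesis using * by (intro that[of p i j j']) (auto simp: coincidences_def)
  next
    case 2
    then show thesis using * by (intro that[of i p j' j]) (auto simp: coincidences_def)
  qed
qed

lemma coincidence_monochromatic:
  assumes "\<And>y. y < k \<Longrightarrow>
    (i, p, j, j') \<in> coincidences m t \<Delta> (a - e * int p * int y, d + e * int y)"
    and "j \<in> {1..m}"
  shows "monochromatic m \<Delta> ((\<lambda>y. a + int i * d + int y * ((int i - int p) * e)) ` {..<k})"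
proof -
  have "\<Delta> (a + int i * d + int y * ((int i - int p) * e)) j = \<Delta> (a + int p * d) j'"
    if "y < k" for y
  proof -
    have "a - e * int p * int y + int i * (d + e * int y)
        = a + int i * d + int y * ((int i - int p) * e)"
      "a - e * int p * int y + int p * (d + e * int y) = a + int p * d"
      by (simp_all add: algebra_simps)
    with assms(1)[OF that] show ?thesis
      by (simp add: coincidences_def)
  qed
  with assms(2) show ?thesis
    unfolding monochromatic_def by (intro bexI[of _ j]) auto
qed

section \<open>Bounding the interval and concluding\<close>

lemma finite_int_pairs_bounded:
  fixes X :: "(int \<times> int) set"
  assumes "finite X"
  obtains M where "M > 0" "\<And>a d. (a, d) \<in> X \<Longrightarrow> \<bar>a\<bar> < M \<and> \<bar>d\<bar> < M"
proof
  let ?M = "1 + (\<Sum>(a, d)\<in>X. \<bar>a\<bar> + \<bar>d\<bar>)"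
  show "?M > 0" by (simp add: add_pos_nonneg sum_nonneg split_beta)
  fix a d assume "(a, d) \<in> X"
  with assms have "\<bar>a\<bar> + \<bar>d\<bar> \<le> (\<Sum>(a, d)\<in>X. \<bar>a\<bar> + \<bar>d\<bar>)"
    using member_le_sum[of "(a, d)" X "\<lambda>(a, d). \<bar>a\<bar> + \<bar>d\<bar>"] by auto
  then show "\<bar>a\<bar> < ?M \<and> \<bar>d\<bar> < ?M" by linarith
qed

theorem theorem4:
  fixes k t m :: nat
  shows "\<exists>N\<^sub>0::nat. N\<^sub>0 \<ge> 1 \<and>
    (\<forall>\<Delta>. type_colouring m N\<^sub>0 \<Delta> \<longrightarrow>
      (\<exists>A. A \<subseteq> {1..int N\<^sub>0} \<and> arith_progression k A \<and> monochromatic m \<Delta> A) \<or>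
      (\<exists>B. B \<subseteq> {1..int N\<^sub>0} \<and> arith_progression t B \<and> rainbow m \<Delta> B))"
proof -
  \<comment> \<open>All \<open>p\<close> are put into one configuration, since the coinciding
    position is known only after the copy is found. The closed ranges ensure that the origin belongs
    to \<open>V\<close> even if \<open>t\<close> or \<open>k\<close> is 0.\<close>
  define V where "V = (\<lambda>(p, y). (- (int p * int y), int y)) ` ({..t} \<times> {..k})"
  define C where "C = Pow ({..<t} \<times> {..<t} \<times> {1..m} \<times> {1..m})"
  have "finite V" "finite C" by (simp_all add: V_def C_def)
  then obtain X where X: "finite X" and Gallai: "\<And>\<chi>. range \<chi> \<subseteq> C \<Longrightarrow> \<exists>a d e c. e > 0 \<and>
      (\<forall>(x, y)\<in>V. (a + e * x, d + e * y) \<in> X \<and> \<chi> (a + e * x, d + e * y) = c)"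
    by (rule gallai_pairs) blast
  obtain M where "M > 0" and M: "\<And>a d. (a, d) \<in> X \<Longrightarrow> \<bar>a\<bar> < M \<and> \<bar>d\<bar> < M"
    by (rule finite_int_pairs_bounded[OF X]) blast
  \<comment> \<open>After a shift by \<open>M\<close>, both base point and difference lie strictly
    between 0 and \<open>2 * M\<close>; this bounds every term with index below
    \<open>t\<close>.\<close>
  define N where "N = nat (2 * M + int t * (2 * M))"
  have N: "int N = 2 * M + int t * (2 * M)" using \<open>M > 0\<close> by (simp add: N_def)
  have term_mem: "a + M + int i * (d + M) \<in> {1..int N}" if "(a, d) \<in> X" "i < t" for a d i
  proof -
    have "0 \<le> int i * (d + M)" "int i * (d + M) \<le> int t * (2 * M)"
      using M[OF that(1)] that(2) by (auto intro!: mult_mono)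
    with M[OF that(1)] N have "1 \<le> a + M + int i * (d + M)" "a + M + int i * (d + M) \<le> int N"
      by linarith+
    then show ?thesis by simp
  qed
  have "(\<exists>A. A \<subseteq> {1..int N} \<and> arith_progression k A \<and> monochromatic m \<Delta> A) \<or>
      (\<exists>B. B \<subseteq> {1..int N} \<and> arith_progression t B \<and> rainbow m \<Delta> B)" for \<Delta>
  proof -
    \<comment> \<open>The shift by \<open>M\<close> makes differences positive and places the
      progressions of pairs in \<open>X\<close> inside \<open>{1..int N}\<close>. Pairs outside
      \<open>X\<close> may read \<Delta> beyond that interval, which is harmless because the copy
      found lies in \<open>X\<close>.\<close>
    let ?\<chi> = "\<lambda>(a, d). coincidences m t \<Delta> (a + M, d + M)"
    have "range ?\<chi> \<subseteq> C" by (auto simp: C_def coincidences_def)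
    from Gallai[OF this] obtain a d e c where e: "e > 0" and
      V: "\<forall>(x, y)\<in>V. (a + e * x, d + e * y) \<in> X \<and> ?\<chi> (a + e * x, d + e * y) = c"
      by blast
    have config: "(a - e * int p * int y, d + e * int y) \<in> X \<and>
        coincidences m t \<Delta> (a + M - e * int p * int y, d + M + e * int y) = c"
      if "p \<le> t" "y \<le> k" for p y
    proof -
      have "(- (int p * int y), int y) \<in> V" using that by (force simp: V_def)
      with V show ?thesis by (auto simp: algebra_simps)
    qed
    have base: "(a, d) \<in> X" "coincidences m t \<Delta> (a + M, d + M) = c"
      using config[of 0 0] by auto
    let ?B = "(\<lambda>i. (a + M) + int i * (d + M)) ` {..<t}"
    have d: "d + M > 0" using M[OF base(1)] by linarith
    show ?thesis
    proof (cases "rainbow m \<Delta> ?B")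
      case True
      moreover have "?B \<subseteq> {1..int N}" using term_mem[OF base(1)] by blast
      moreover have "arith_progression t ?B" using d unfolding arith_progression_def by blast
      ultimately show ?thesis by blast
    next
      case False
      then obtain i p j j' where ip: "p < i" and co: "(i, p, j, j') \<in> c"
        using rainbow_or_coincidence base(2) by metis
      then have "i < t" "p < t" "j \<in> {1..m}"
        using base(2) by (auto simp: coincidences_def)
      let ?A = "(\<lambda>y. (a + M) + int i * (d + M) + int y * ((int i - int p) * e)) ` {..<k}"
      have "monochromatic m \<Delta> ?A"
        using config[of p] co \<open>p < t\<close> \<open>j \<in> {1..m}\<close>
        by (intro coincidence_monochromatic[where p = p and j = j and j' = j' and t = t]) auto
      moreover have "arith_progression k ?A"
        unfolding arith_progression_def using ip e
        by (intro exI[of _ "(a + M) + int i * (d + M)"] exI[of _ "(int i - int p) * e"]) simp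
      moreover have "?A \<subseteq> {1..int N}"
      proof
        fix z assume "z \<in> ?A"
        then obtain y where y: "y < k"
          and z: "z = (a + M) + int i * (d + M) + int y * ((int i - int p) * e)"
          by blast
        \<comment> \<open>Each element of \<open>?A\<close> is the \<open>i\<close>-th term of the
          progression of a pair in the copy, so \<open>term_mem\<close> applies.\<close>
        have "z = a - e * int p * int y + M + int i * (d + e * int y + M)"
          by (simp add: z algebra_simps)
        with term_mem[OF _ \<open>i < t\<close>] config[of p y] y \<open>p < t\<close> show "z \<in> {1..int N}"
          by simp
      qed
      ultimately show ?thesis by blast
    qed
  qed
  moreover have "N \<ge> 1"
    using \<open>M > 0\<close> by (simp add: N_def le_nat_iff add_pos_nonneg Suc_le_eq)
  ultimately show ?thesis by blast
qed

end
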